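(* Let $X, X_1, X_2,\ldots$ be independent and identically distributed real-valued random variables with common cumulative distribution function $F$, and let $lep(F)$ and $uep(F)$ be the lower and upper endpoints of $F$. Put $p_1=\mathbb{P}(X=lep(F))$, $p_2=\mathbb{P}(X=uep(F))$ and $p_3=1-p_1-p_2$. (a) If $uep(F)\in\mathbb{R}$ and $p_2\in\,]0,1[$, then the sequence $(N_{k,2})_{k\geq 1}$ of hitting times of $uep(F)$ is (almost surely) an infinite sequence and, for all $k\geq 1$, $N_{k,2}$ follows the negative binomial law $\beta N(k,p_2)$. (b) If $lep(F)\in\mathbb{R}$ and $p_1\in\,]0,1[$, then the sequence $(N_{k,1})_{k\geq 1}$ of hitting times of $lep(F)$ is (almost surely) infinite and, for all $k\geq 1$, $N_{k,1}$ follows the negative binomial law $\beta N(k,p_1)$. (c) If $lep(F),uep(F)\in\mathbb{R}$, $p_1\in\,]0,1[$, $p_2\in\,]0,1[$ and $0<p_1+p_2<1$, then the sequence $(N_{k,3})_{k\geq 1}$ of times at which neither endpoint is hit is (almost surely) infinite and, for all $k\geq 1$, $N_{k,3}$ follows the negative binomial law $\beta N(k,p_3)$.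
   Context: Endpoints: $lep(F)=\inf\{x\in\mathbb{R}: F(x)>0\}$ and $uep(F)=\sup\{x\in\mathbb{R}: F(x)<1\}$. The sequence $N_{1,1}<N_{2,1}<\cdots$ is the increasing enumeration of $\{j\geq 1: X_j=lep(F)\}$; $N_{1,2}<N_{2,2}<\cdots$ is the increasing enumeration of $\{j\geq 1: X_j=uep(F)\}$; $N_{1,3}<N_{2,3}<\cdots$ is the increasing enumeration of $\{j\geq 1: X_j\neq lep(F)\text{ and }X_j\neq uep(F)\}$. For $p\in\,]0,1[$, the negative binomial law $\beta N(k,p)$ is the law of the sum of $k$ independent geometric random variables $Z$ with $\mathbb{P}(Z=h)=(1-p)^{h-1}p$, $h\geq 1$ (the number of trials until the $k$-th success). *)

theory Defs
  imports "HOL-Probability.Probability" "HOL-Library.Infinite_Set"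
begin

text \<open>
  The endpoints are extended reals: they may be infinite, although the random variables
  are real-valued.
\<close>

definition lep :: "(real \<Rightarrow> real) \<Rightarrow> ereal" where
  "lep F = (INF x\<in>{x. F x > 0}. ereal x)"

definition uep :: "(real \<Rightarrow> real) \<Rightarrow> ereal" where
  "uep F = (SUP x\<in>{x. F x < 1}. ereal x)"

definition lep_hits :: "(real \<Rightarrow> real) \<Rightarrow> (nat \<Rightarrow> 'a \<Rightarrow> real) \<Rightarrow> 'a \<Rightarrow> nat set" where
  "lep_hits F X \<omega> = {j. j \<ge> 1 \<and> ereal (X j \<omega>) = lep F}"

definition uep_hits :: "(real \<Rightarrow> real) \<Rightarrow> (nat \<Rightarrow> 'a \<Rightarrow> real) \<Rightarrow> 'a \<Rightarrow> nat set" where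
  "uep_hits F X \<omega> = {j. j \<ge> 1 \<and> ereal (X j \<omega>) = uep F}"

definition non_hits :: "(real \<Rightarrow> real) \<Rightarrow> (nat \<Rightarrow> 'a \<Rightarrow> real) \<Rightarrow> 'a \<Rightarrow> nat set" where
  "non_hits F X \<omega> = {j. j \<ge> 1 \<and> ereal (X j \<omega>) \<noteq> lep F \<and> ereal (X j \<omega>) \<noteq> uep F}"

text \<open>
  The \<open>k\<close>-th smallest element of \<open>S\<close>, counted from \<open>k = 1\<close> (whereas \<open>enumerate\<close> counts
  from 0).  The value is an unspecified number if \<open>S\<close> has fewer than \<open>k\<close> elements, so it is
  meaningful for a random set only together with the almost sure infinity of that set.
\<close>

definition kth_time :: "nat set \<Rightarrow> nat \<Rightarrow> nat" where
  "kth_time S k = enumerate S (k - 1)"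

text \<open>
  The law of the number of trials until the \<open>k\<close>-th success, as the law of the sum of \<open>k\<close>
  independent geometric variables on \<open>{1, 2, ...}\<close>.  The library's \<open>geometric_pmf\<close> and
  \<open>neg_binomial_pmf\<close> count failures only, hence the shift by \<open>Suc\<close>.
\<close>

definition neg_binomial_trials_pmf :: "nat \<Rightarrow> real \<Rightarrow> nat pmf" where
  "neg_binomial_trials_pmf k p =
     map_pmf sum_list (replicate_pmf k (map_pmf Suc (geometric_pmf p)))"

lemma pmf_Suc_geometric:
  assumes "0 < p" "p \<le> 1" "h \<ge> 1"
  shows "pmf (map_pmf Suc (geometric_pmf p)) h = (1 - p) ^ (h - 1) * p"
proof -
  obtain n where h: "h = Suc n" using assms(3) by (cases h) auto
  have "pmf (map_pmf Suc (geometric_pmf p)) (Suc n) = pmf (geometric_pmf p) n"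
    by (rule pmf_map_inj') simp
  then show ?thesis using assms h by simp
qed

end

theory Submission
  imports Defs
begin

text \<open>
  The \<open>k\<close>-th hitting time equals \<open>m\<close> iff \<open>m\<close> is hit and exactly \<open>k - 1\<close> of the earlier times
  are; by independence this has the negative binomial probability.  Since these
  probabilities sum to \<open>1\<close> over \<open>m\<close>, almost surely a \<open>k\<close>-th hit exists for every \<open>k\<close>, which is the
  infinity of the hitting set.  For the third part, the two endpoints have to be distinct,
  as otherwise \<open>X\<close> would be almost surely constant and \<open>p1 = 1\<close>.
\<close>

section \<open>Enumeration of random sets of natural numbers\<close>

lemma measurable_enumerate [measurable (raw)]:
  fixes S :: "'a \<Rightarrow> nat set"
  assumes "\<And>j. Measurable.pred M (\<lambda>\<omega>. j \<in> S \<omega>)"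
  shows "(\<lambda>\<omega>. enumerate (S \<omega>) n) \<in> measurable M (count_space UNIV)"
  using assms
proof (induction n arbitrary: S)
  case 0
  then show ?case
    unfolding enumerate_0 by (intro measurable_Least)
next
  case (Suc n)
  have [measurable]: "Measurable.pred M (\<lambda>\<omega>. j \<in> S \<omega>)" for j
    by (rule Suc.prems)
  \<comment> \<open>Deleting the least element preserves measurable membership, so the induction
    runs over arbitrary \<open>S\<close>. On an empty set \<open>LEAST\<close> is a fixed
    unspecified number, so finite sets do no harm.\<close>
  have "Measurable.pred M (\<lambda>\<omega>. j \<in> S \<omega> - {LEAST i. i \<in> S \<omega>})" for j
    by simp
  then show ?case
    unfolding enumerate_Suc by (rule Suc.IH)
qed

text \<open>Deleting the least element, which lies below \<open>s\<close> unless it is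
  \<open>s\<close>, lowers the count of predecessors of \<open>s\<close> by one. \<open>S\<close>
  may be finite here, so the rule applies pointwise before the hitting set is known to be
  infinite.\<close>

lemma enumerate_eqI:
  fixes S :: "nat set"
  assumes "s \<in> S" "card {t \<in> S. t < s} = n"
  shows "enumerate S n = s"
  using assms
proof (induction n arbitrary: S)
  case 0
  then have "t \<in> S \<Longrightarrow> s \<le> t" for t
    by (auto simp: not_less [symmetric])
  with 0 show ?case
    unfolding enumerate_0 by (auto intro!: Least_equality)
next
  case (Suc n)
  let ?l = "LEAST t. t \<in> S"
  obtain t where t: "t \<in> S" "t < s"
    using Suc.prems(2) by (metis (no_types, lifting) card.empty empty_Collect_eq nat.distinct(1))
  have l: "?l \<in> S" "?l < s"
    using t by (auto intro: LeastI le_less_trans [OF Least_le])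
  have "{t \<in> S - {?l}. t < s} = {t \<in> S. t < s} - {?l}"
    by auto
  then have "card {t \<in> S - {?l}. t < s} = n"
    using Suc.prems(2) l by simp
  then show ?case
    unfolding enumerate_Suc using l Suc.prems(1) by (intro Suc.IH) auto
qed

section \<open>The negative binomial law in closed form\<close>

lemma neg_binomial_trials_pmf_conv_neg_binomial_pmf:
  "neg_binomial_trials_pmf k p = map_pmf ((+) k) (neg_binomial_pmf k p)"
proof (induction k)
  case 0
  show ?case by (simp add: neg_binomial_trials_pmf_def)
next
  case (Suc k)
  \<comment> \<open>Split off one geometric summand. Each summand carries one \<open>Suc\<close>,
    and together they make up the shift by the number of successes.\<close>
  have "neg_binomial_trials_pmf (Suc k) p =
      bind_pmf (geometric_pmf p) (\<lambda>x. map_pmf ((+) (Suc x)) (neg_binomial_trials_pmf k p))"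
    by (simp add: neg_binomial_trials_pmf_def map_pmf_def bind_assoc_pmf bind_return_pmf)
  then show ?case
    by (simp add: Suc.IH neg_binomial_pmf_Suc pair_pmf_def map_pmf_def bind_assoc_pmf
        bind_return_pmf add_ac)
qed

text \<open>Both indices are successors in order to single out the last trial, a success; the
  binomial coefficient places the other \<open>k\<close> successes among the \<open>m\<close>
  earlier trials. For \<open>m < k\<close> both sides vanish.\<close>

lemma pmf_neg_binomial_trials:
  assumes "p \<in> {0<..1}"
  shows "pmf (neg_binomial_trials_pmf (Suc k) p) (Suc m) =
    real (m choose k) * p ^ Suc k * (1 - p) ^ (m - k)"
proof (cases "k \<le> m")
  case True
  \<comment> \<open>The argument is written as successes plus failures, so that the injective shift
    by \<open>Suc k\<close> can be undone.\<close>
  have "pmf (neg_binomial_trials_pmf (Suc k) p) (Suc k + (m - k)) =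
      real (m choose (m - k)) * p ^ Suc k * (1 - p) ^ (m - k)"
    unfolding neg_binomial_trials_pmf_conv_neg_binomial_pmf using assms True
    by (subst pmf_map_inj') (auto simp: inj_def pmf_neg_binomial)
  with True show ?thesis
    by (simp add: binomial_symmetric [of k m])
next
  case False
  then have "Suc m \<notin> set_pmf (neg_binomial_trials_pmf (Suc k) p)"
    by (auto simp: neg_binomial_trials_pmf_conv_neg_binomial_pmf)
  with False show ?thesis
    by (simp add: set_pmf_iff)
qed

lemma pmf_neg_binomial_trials_0: "pmf (neg_binomial_trials_pmf (Suc k) p) 0 = 0"
  unfolding neg_binomial_trials_pmf_conv_neg_binomial_pmf by (auto simp: pmf_eq_0_set_pmf)

section \<open>Success times in a sequence of independent trials\<close>

lemma infiniteI_card_less: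
  fixes S :: "nat set"
  assumes "\<And>k. \<exists>s\<in>S. card {t \<in> S. t < s} = k"
  shows "infinite S"
proof
  assume "finite S"
  \<comment> \<open>Taking \<open>k = card S\<close> puts all of \<open>S\<close> strictly below
    \<open>s\<close>, including \<open>s\<close> itself.\<close>
  obtain s where s: "s \<in> S" "card {t \<in> S. t < s} = card S"
    using assms by blast
  then have "{t \<in> S. t < s} = S"
    using \<open>finite S\<close> by (intro card_subset_eq) auto
  with s show False by auto
qed

context prob_space
begin

lemma prob_success_pattern:
  assumes indep: "indep_vars (\<lambda>_. N) Y {1..}" and B: "B \<in> sets N"
    and p: "\<And>j. j \<ge> 1 \<Longrightarrow> prob (Y j -` B \<inter> space M) = p"
    and A: "A \<subseteq> {1..m::nat}"
  shows "prob {\<omega> \<in> space M. \<forall>j\<in>{1..m}. Y j \<omega> \<in> B \<longleftrightarrow> j \<in> A} =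
    p ^ card A * (1 - p) ^ (m - card A)"
\<comment> \<open>The empty pattern is treated apart: an intersection over no index would be
  \<open>UNIV\<close> instead of \<open>space M\<close>.\<close>
proof (cases "m = 0")
  case True
  with A show ?thesis by (auto simp: prob_space)
next
  case False
  \<comment> \<open>The set that the pattern prescribes at time \<open>j\<close>; the complement
    within \<open>space N\<close> keeps it measurable, so independence yields a product of factors
    \<open>p\<close> and \<open>1 - p\<close>.\<close>
  define C where "C j = (if j \<in> A then B else space N - B)" for j
  have meas: "Y j \<in> measurable M N" if "j \<ge> 1" for j
    using indep that by (auto simp: indep_vars_def2)
  have C: "prob (Y j -` C j \<inter> space M) = (if j \<in> A then p else 1 - p)" if "j \<ge> 1" for j
  proof (cases "j \<in> A")
    case True
    then show ?thesis by (simp add: C_def p [OF that])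
  next
    case False
    have "Y j -` C j \<inter> space M = space M - (Y j -` B \<inter> space M)"
      using False measurable_space [OF meas [OF that]] by (auto simp: C_def)
    then show ?thesis
      using False prob_compl [OF measurable_sets [OF meas [OF that] B]] p [OF that] by simp
  qed
  have "{\<omega> \<in> space M. \<forall>j\<in>{1..m}. Y j \<omega> \<in> B \<longleftrightarrow> j \<in> A} = (\<Inter>j\<in>{1..m}. Y j -` C j \<inter> space M)"
    using False measurable_space [OF meas] by (fastforce simp: C_def split: if_splits)
  also have "prob \<dots> = (\<Prod>j\<in>{1..m}. prob (Y j -` C j \<inter> space M))"
    using False B by (intro indep_varsD [OF indep]) (auto simp: C_def)
  also have "\<dots> = (\<Prod>j\<in>{1..m}. if j \<in> A then p else 1 - p)"
    by (intro prod.cong) (auto simp: C)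
  also have "\<dots> = p ^ card ({1..m} \<inter> A) * (1 - p) ^ card ({1..m} - A)"
    by (simp add: prod.If_cases Diff_eq)
  also have "\<dots> = p ^ card A * (1 - p) ^ (m - card A)"
    using A by (simp add: Int_absorb1 card_Diff_subset finite_subset)
  finally show ?thesis .
qed

text \<open>A general success set \<open>B\<close> lets one statement serve the hits of either
  endpoint as well as the times that avoid both.\<close>

theorem kth_success_time:
  fixes Y :: "nat \<Rightarrow> 'a \<Rightarrow> 'b"
  assumes indep: "indep_vars (\<lambda>_. N) Y {1..}" and B: "B \<in> sets N"
    and p: "\<And>j. j \<ge> 1 \<Longrightarrow> prob (Y j -` B \<inter> space M) = p" "p \<in> {0<..1}"
  defines "S \<equiv> \<lambda>\<omega>. {j. j \<ge> 1 \<and> Y j \<omega> \<in> B}"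
  shows "AE \<omega> in M. infinite (S \<omega>)"
    and "k \<ge> 1 \<Longrightarrow> (\<lambda>\<omega>. kth_time (S \<omega>) k) \<in> measurable M (count_space UNIV)"
    and "k \<ge> 1 \<Longrightarrow> distr M (count_space UNIV) (\<lambda>\<omega>. kth_time (S \<omega>) k) =
      measure_pmf (neg_binomial_trials_pmf k p)"
proof -
  have pred [measurable]: "Measurable.pred M (\<lambda>\<omega>. j \<in> S \<omega>)" for j
  proof (cases "j \<ge> 1")
    case True
    then have "Y j \<in> measurable M N"
      using indep by (auto simp: indep_vars_def2)
    with B have "Measurable.pred M (\<lambda>\<omega>. Y j \<omega> \<in> B)"
      by measurable
    with True show ?thesis by (simp add: S_def)
  qed (simp add: S_def)
  \<comment> \<open>The event that success number \<open>k + 1\<close> happens at time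
    \<open>m\<close>; \<open>k\<close> counts from 0, as in \<open>enumerate\<close>.\<close>
  define H where "H k m = {\<omega> \<in> space M. m \<in> S \<omega> \<and> card {t \<in> S \<omega>. t < m} = k}" for k m
  \<comment> \<open>Split by the set \<open>A\<close> of earlier success times; each piece is a
    pattern covered by \<open>prob_success_pattern\<close>.\<close>
  have H_Suc: "H k (Suc m) = (\<Union>A\<in>{A. A \<subseteq> {1..m} \<and> card A = k}.
      {\<omega> \<in> space M. \<forall>j\<in>{1..Suc m}. Y j \<omega> \<in> B \<longleftrightarrow> j \<in> insert (Suc m) A})" for k m
  proof (intro equalityI subsetI)
    fix \<omega> assume \<omega>: "\<omega> \<in> H k (Suc m)"
    then show "\<omega> \<in> (\<Union>A\<in>{A. A \<subseteq> {1..m} \<and> card A = k}.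
        {\<omega> \<in> space M. \<forall>j\<in>{1..Suc m}. Y j \<omega> \<in> B \<longleftrightarrow> j \<in> insert (Suc m) A})"
      by (intro UN_I [of "{t \<in> S \<omega>. t < Suc m}"]) (auto simp: H_def S_def)
  next
    fix \<omega> assume "\<omega> \<in> (\<Union>A\<in>{A. A \<subseteq> {1..m} \<and> card A = k}.
        {\<omega> \<in> space M. \<forall>j\<in>{1..Suc m}. Y j \<omega> \<in> B \<longleftrightarrow> j \<in> insert (Suc m) A})"
    then obtain A where A: "A \<subseteq> {1..m}" "card A = k" "\<omega> \<in> space M"
      "\<And>j. j \<in> {1..Suc m} \<Longrightarrow> Y j \<omega> \<in> B \<longleftrightarrow> j \<in> insert (Suc m) A"
      by blast
    then have "{t \<in> S \<omega>. t < Suc m} = A"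
      by (fastforce simp: S_def)
    with A show "\<omega> \<in> H k (Suc m)"
      by (auto simp: H_def S_def)
  qed
  have event: "{\<omega> \<in> space M. \<forall>j\<in>{1..m}. Y j \<omega> \<in> B \<longleftrightarrow> j \<in> A} \<in> events" for m A
  proof -
    have "{\<omega> \<in> space M. \<forall>j\<in>{1..m}. Y j \<omega> \<in> B \<longleftrightarrow> j \<in> A} =
        {\<omega> \<in> space M. \<forall>j\<in>{1..m}. j \<in> S \<omega> \<longleftrightarrow> j \<in> A}"
      by (auto simp: S_def)
    then show ?thesis by simp
  qed
  have H_0: "H k 0 = {}" for k
    by (auto simp: H_def S_def)
  have H_event [measurable]: "H k m \<in> events" for k m
  proof (cases m)
    case (Suc n)
    show ?thesis
      unfolding Suc H_Suc by (intro sets.finite_UN event) auto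
  qed (simp add: H_0)
  have prob_H: "prob (H k m) = pmf (neg_binomial_trials_pmf (Suc k) p) m" for k m
  proof (cases m)
    case 0
    then show ?thesis by (simp add: H_0 pmf_neg_binomial_trials_0)
  next
    case (Suc n)
    let ?E = "\<lambda>A. {\<omega> \<in> space M. \<forall>j\<in>{1..Suc n}. Y j \<omega> \<in> B \<longleftrightarrow> j \<in> insert (Suc n) A}"
    let ?I = "{A. A \<subseteq> {1..n} \<and> card A = k}"
    \<comment> \<open>Distinct \<open>A\<close> and \<open>A'\<close> differ at some
      \<open>j \<le> n\<close>, and inserting \<open>Suc n\<close> into both does not remove that
      difference.\<close>
    have disj: "disjoint_family_on ?E ?I"
    proof (unfold disjoint_family_on_def, intro ballI impI)
      fix A A' assume A: "A \<in> ?I" "A' \<in> ?I" "A \<noteq> A'"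
      then obtain j where "j \<in> {1..n}" "j \<in> A \<longleftrightarrow> j \<notin> A'"
        by blast
      then have "j \<in> {1..Suc n}" "j \<in> insert (Suc n) A \<longleftrightarrow> j \<notin> insert (Suc n) A'"
        by auto
      then show "?E A \<inter> ?E A' = {}"
        by blast
    qed
    have "prob (H k m) = (\<Sum>A\<in>?I. prob (?E A))"
      unfolding Suc H_Suc
    proof (rule finite_measure_finite_Union [OF _ _ disj])
      show "finite ?I" by simp
      show "?E ` ?I \<subseteq> events" using event [of "Suc n"] by blast
    qed
    \<comment> \<open>Every pattern has \<open>Suc k\<close> successes among \<open>Suc n\<close>
      trials, so all summands agree and only the number of \<open>k\<close>-subsets remains.\<close>
    also have "\<dots> = (\<Sum>A\<in>?I. p ^ Suc k * (1 - p) ^ (n - k))"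
    proof (intro sum.cong refl)
      fix A assume A: "A \<in> ?I"
      then have "finite A" "Suc n \<notin> A"
        by (auto intro: finite_subset)
      moreover have "insert (Suc n) A \<subseteq> {1..Suc n}"
        using A by auto
      ultimately show "prob (?E A) = p ^ Suc k * (1 - p) ^ (n - k)"
        using A prob_success_pattern [OF indep B p(1), where A = "insert (Suc n) A" and m = "Suc n"]
        by simp
    qed
    also have "\<dots> = real (n choose k) * p ^ Suc k * (1 - p) ^ (n - k)"
      using n_subsets [of "{1..n}" k] by simp
    finally show ?thesis
      using p(2) by (simp only: Suc pmf_neg_binomial_trials)
  qed
  have "AE \<omega> in M. \<exists>m. \<omega> \<in> H k m" for k
  proof -
    \<comment> \<open>For fixed \<open>k\<close>, membership in \<open>H k m\<close> forces
      \<open>m = enumerate (S \<omega>) k\<close>. Disjointness then turns the probability of the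
      union into the total mass of the law.\<close>
    have disj: "disjoint_family (H k)"
    proof (unfold disjoint_family_on_def, safe)
      fix m n \<omega> assume "m \<noteq> n" "\<omega> \<in> H k m" "\<omega> \<in> H k n"
      then show "\<omega> \<in> {}"
        unfolding H_def using enumerate_eqI [of _ "S \<omega>" k] by auto
    qed
    have "emeasure M (\<Union>m. H k m) = (\<Sum>m. emeasure M (H k m))"
      using disj by (intro suminf_emeasure [symmetric]) auto
    also have "\<dots> = (\<Sum>m. emeasure (measure_pmf (neg_binomial_trials_pmf (Suc k) p)) {m})"
      by (simp add: emeasure_eq_measure prob_H emeasure_pmf_single)
    also have "\<dots> = emeasure (measure_pmf (neg_binomial_trials_pmf (Suc k) p)) (\<Union>m. {m})"
      by (intro suminf_emeasure) (auto simp: disjoint_family_on_def)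
    also have "\<dots> = 1"
      using measure_pmf.emeasure_space_1 [of "neg_binomial_trials_pmf (Suc k) p"] by simp
    finally have "prob (\<Union>m. H k m) = 1"
      by (simp add: emeasure_eq_measure)
    then have "AE \<omega> in M. \<omega> \<in> (\<Union>m. H k m)"
      by (simp add: prob_eq_1)
    then show ?thesis by simp
  qed
  then have AE_H: "AE \<omega> in M. \<forall>k. \<exists>m. \<omega> \<in> H k m"
    by (simp add: AE_all_countable)
  then show "AE \<omega> in M. infinite (S \<omega>)"
  proof eventually_elim
    case (elim \<omega>)
    show "infinite (S \<omega>)"
    proof (rule infiniteI_card_less)
      fix k
      obtain m where "\<omega> \<in> H k m"
        using elim by blast
      then show "\<exists>s\<in>S \<omega>. card {t \<in> S \<omega>. t < s} = k"
        by (auto simp: H_def)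
    qed
  qed
  have meas: "(\<lambda>\<omega>. kth_time (S \<omega>) k) \<in> measurable M (count_space UNIV)" for k
    unfolding kth_time_def by measurable
  then show "(\<lambda>\<omega>. kth_time (S \<omega>) k) \<in> measurable M (count_space UNIV)" .
  assume "k \<ge> 1"
  then obtain n where k: "k = Suc n"
    by (cases k) auto
  show "distr M (count_space UNIV) (\<lambda>\<omega>. kth_time (S \<omega>) k) =
      measure_pmf (neg_binomial_trials_pmf k p)"
  proof (rule measure_eqI_countable [of _ UNIV])
    fix m :: nat
    \<comment> \<open>Where there is no \<open>k\<close>-th success, \<open>kth_time\<close> is a
      default value and the equivalence may fail; \<open>AE_H\<close> confines this to a null
      set.\<close>
    have "AE \<omega> in M. kth_time (S \<omega>) k = m \<longleftrightarrow> \<omega> \<in> H n m"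
      using AE_H AE_space
    proof eventually_elim
      case (elim \<omega>)
      obtain m' where m': "\<omega> \<in> H n m'"
        using elim by blast
      have eq: "kth_time (S \<omega>) k = i" if "\<omega> \<in> H n i" for i
        using that unfolding kth_time_def k by (auto simp: H_def intro!: enumerate_eqI)
      show ?case
        using eq m' by metis
    qed
    then have "emeasure M ((\<lambda>\<omega>. kth_time (S \<omega>) k) -` {m} \<inter> space M) = emeasure M (H n m)"
      using measurable_sets [OF meas, of "{m}"] by (intro emeasure_eq_AE) auto
    then show "emeasure (distr M (count_space UNIV) (\<lambda>\<omega>. kth_time (S \<omega>) k)) {m} =
        emeasure (measure_pmf (neg_binomial_trials_pmf k p)) {m}"
      using meas by (simp add: emeasure_distr emeasure_eq_measure prob_H k emeasure_pmf_single)
  qed auto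
qed

section \<open>Endpoints of the distribution and their hitting times\<close>

lemma AE_const_if_lep_eq_uep:
  assumes X [measurable]: "random_variable borel X"
    and F: "F = cdf (distr M borel X)" and c: "lep F = ereal c" "uep F = ereal c"
  shows "AE \<omega> in M. X \<omega> = c"
proof -
  have F_prob: "F x = \<P>(\<omega> in M. X \<omega> \<le> x)" for x
    unfolding F cdf_def by (subst measure_distr) (auto intro!: arg_cong [where f = prob])
  \<comment> \<open>\<open>F\<close> vanishes below \<open>lep F\<close> and equals 1 above
    \<open>uep F\<close>. The margins \<open>1 / real (Suc n)\<close> give only countably many
    almost sure bounds, which therefore hold simultaneously.\<close>
  have "AE \<omega> in M. c - 1 / real (Suc n) < X \<omega>" for n
  proof -
    have "\<not> F (c - 1 / real (Suc n)) > 0"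
    proof
      assume "F (c - 1 / real (Suc n)) > 0"
      then have "lep F \<le> ereal (c - 1 / real (Suc n))"
        unfolding lep_def by (intro INF_lower) auto
      then show False by (simp add: c)
    qed
    then have "\<P>(\<omega> in M. X \<omega> \<le> c - 1 / real (Suc n)) = 0"
      by (simp add: F_prob zero_less_measure_iff)
    then show ?thesis
      by (subst (asm) prob_Collect_eq_0) (auto simp: not_le)
  qed
  moreover have "AE \<omega> in M. X \<omega> \<le> c + 1 / real (Suc n)" for n
  proof -
    have "\<not> F (c + 1 / real (Suc n)) < 1"
    proof
      assume "F (c + 1 / real (Suc n)) < 1"
      then have "ereal (c + 1 / real (Suc n)) \<le> uep F"
        unfolding uep_def by (intro SUP_upper) auto
      then show False by (simp add: c)
    qed
    then have "\<P>(\<omega> in M. X \<omega> \<le> c + 1 / real (Suc n)) = 1"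
      by (simp add: F_prob not_less antisym [OF prob_le_1])
    then show ?thesis
      by (subst (asm) prob_Collect_eq_1) auto
  qed
  ultimately have "AE \<omega> in M. \<forall>n. c - 1 / real (Suc n) < X \<omega> \<and> X \<omega> \<le> c + 1 / real (Suc n)"
    by (simp add: AE_all_countable)
  then show ?thesis
  proof eventually_elim
    case (elim \<omega>)
    show ?case
    proof (rule ccontr)
      assume "X \<omega> \<noteq> c"
      then obtain n where "1 / real (Suc n) < \<bar>X \<omega> - c\<bar>"
        using nat_approx_posE [of "\<bar>X \<omega> - c\<bar>"] by auto
      with elim show False
        by (smt (verit))
    qed
  qed
qed

end

text \<open>\<open>Xs(0 := X)\<close> places \<open>X\<close> at index 0, so that a single
  hypothesis expresses the independence of \<open>X, X_1, X_2, ...\<close>. Measurability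
  accompanies each law because \<open>distr\<close> is meaningful only for measurable maps.\<close>

theorem theorem1:
  fixes M :: "'a measure"
    and X :: "'a \<Rightarrow> real"
    and Xs :: "nat \<Rightarrow> 'a \<Rightarrow> real"
    and F :: "real \<Rightarrow> real"
    and p1 p2 p3 :: real
  assumes "prob_space M"
    and "prob_space.indep_vars M (\<lambda>_. borel) (Xs(0 := X)) UNIV"
    and "\<And>j. j \<ge> 1 \<Longrightarrow> distr M borel (Xs j) = distr M borel X"
    and "F = cdf (distr M borel X)"
    and "p1 = measure M {\<omega> \<in> space M. ereal (X \<omega>) = lep F}"
    and "p2 = measure M {\<omega> \<in> space M. ereal (X \<omega>) = uep F}"
    and "p3 = 1 - p1 - p2"
  shows
    "(\<bar>uep F\<bar> \<noteq> \<infinity> \<and> p2 \<in> {0<..<1} \<longrightarrow>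
        (AE \<omega> in M. infinite (uep_hits F Xs \<omega>)) \<and>
        (\<forall>k\<ge>1. (\<lambda>\<omega>. kth_time (uep_hits F Xs \<omega>) k) \<in> measurable M (count_space UNIV) \<and>
          distr M (count_space UNIV) (\<lambda>\<omega>. kth_time (uep_hits F Xs \<omega>) k)
            = measure_pmf (neg_binomial_trials_pmf k p2))) \<and>
     (\<bar>lep F\<bar> \<noteq> \<infinity> \<and> p1 \<in> {0<..<1} \<longrightarrow>
        (AE \<omega> in M. infinite (lep_hits F Xs \<omega>)) \<and>
        (\<forall>k\<ge>1. (\<lambda>\<omega>. kth_time (lep_hits F Xs \<omega>) k) \<in> measurable M (count_space UNIV) \<and>
          distr M (count_space UNIV) (\<lambda>\<omega>. kth_time (lep_hits F Xs \<omega>) k)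
            = measure_pmf (neg_binomial_trials_pmf k p1))) \<and>
     (\<bar>lep F\<bar> \<noteq> \<infinity> \<and> \<bar>uep F\<bar> \<noteq> \<infinity> \<and> p1 \<in> {0<..<1} \<and> p2 \<in> {0<..<1} \<and>
        0 < p1 + p2 \<and> p1 + p2 < 1 \<longrightarrow>
        (AE \<omega> in M. infinite (non_hits F Xs \<omega>)) \<and>
        (\<forall>k\<ge>1. (\<lambda>\<omega>. kth_time (non_hits F Xs \<omega>) k) \<in> measurable M (count_space UNIV) \<and>
          distr M (count_space UNIV) (\<lambda>\<omega>. kth_time (non_hits F Xs \<omega>) k)
            = measure_pmf (neg_binomial_trials_pmf k p3)))"
proof -
  interpret prob_space M by fact
  have indep: "indep_vars (\<lambda>_. borel) Xs {1..}"
  proof -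
    have "indep_vars (\<lambda>_. borel) (Xs(0 := X)) {1..}"
      by (rule indep_vars_subset [OF assms(2)]) auto
    then show ?thesis
      by (subst indep_vars_cong [where Y = "Xs(0 := X)"]) auto
  qed
  have X: "random_variable borel X"
    using assms(2) unfolding indep_vars_def2 by (auto split: if_splits dest: spec [of _ 0])
  have Xs: "random_variable borel (Xs j)" if "j \<ge> 1" for j
    using indep that by (auto simp: indep_vars_def2)
  have prob_Xs: "prob (Xs j -` B \<inter> space M) = prob {\<omega> \<in> space M. X \<omega> \<in> B}"
    if "j \<ge> 1" "B \<in> sets borel" for j B
    using measure_distr [OF Xs [OF that(1)] that(2)] measure_distr [OF X that(2)]
      assms(3) [OF that(1)] by (simp add: vimage_def Int_def conj_commute)
  \<comment> \<open>The predicate \<open>Q\<close> on extended reals matches the three unfolded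
    hitting sets, so each claim is an instance.\<close>
  have law: "(AE \<omega> in M. infinite {j. j \<ge> 1 \<and> Q (ereal (Xs j \<omega>))}) \<and>
      (\<forall>k\<ge>1. (\<lambda>\<omega>. kth_time {j. j \<ge> 1 \<and> Q (ereal (Xs j \<omega>))} k)
          \<in> measurable M (count_space UNIV) \<and>
        distr M (count_space UNIV) (\<lambda>\<omega>. kth_time {j. j \<ge> 1 \<and> Q (ereal (Xs j \<omega>))} k)
          = measure_pmf (neg_binomial_trials_pmf k p))"
    if Q: "{x. Q (ereal x)} \<in> sets borel"
      and p: "p = prob {\<omega> \<in> space M. Q (ereal (X \<omega>))}" "p \<in> {0<..1}" for Q p
    using kth_success_time [OF indep Q _ p(2)] prob_Xs [OF _ Q] p(1) by simp
  \<comment> \<open>Distinct endpoints make the two hitting events disjoint, so their union has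
    probability \<open>p1 + p2\<close>.\<close>
  have p3: "p3 = prob {\<omega> \<in> space M. ereal (X \<omega>) \<noteq> lep F \<and> ereal (X \<omega>) \<noteq> uep F}"
    if fin: "\<bar>lep F\<bar> \<noteq> \<infinity>" "\<bar>uep F\<bar> \<noteq> \<infinity>" and p1: "p1 < 1"
  proof -
    obtain a b where ab: "lep F = ereal a" "uep F = ereal b"
      using fin by auto
    have "a \<noteq> b"
    proof
      assume "a = b"
      then have "AE \<omega> in M. X \<omega> = a"
        using AE_const_if_lep_eq_uep [OF X assms(4)] ab by simp
      then have "p1 = 1"
        unfolding assms(5) ab using X by (subst prob_Collect_eq_1) auto
      with p1 show False by simp
    qed
    have ev: "{\<omega> \<in> space M. X \<omega> = x} \<in> events" for x
      using X by measurable
    have "{\<omega> \<in> space M. ereal (X \<omega>) \<noteq> lep F \<and> ereal (X \<omega>) \<noteq> uep F} =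
        space M - ({\<omega> \<in> space M. X \<omega> = a} \<union> {\<omega> \<in> space M. X \<omega> = b})"
      by (auto simp: ab)
    also have "prob \<dots> = 1 - prob ({\<omega> \<in> space M. X \<omega> = a} \<union> {\<omega> \<in> space M. X \<omega> = b})"
      using ev by (intro prob_compl) auto
    also have "prob ({\<omega> \<in> space M. X \<omega> = a} \<union> {\<omega> \<in> space M. X \<omega> = b}) = p1 + p2"
      using ev \<open>a \<noteq> b\<close> by (subst finite_measure_Union) (auto simp: assms(5,6) ab)
    finally show ?thesis
      using assms(7) by simp
  qed
  show ?thesis
    unfolding uep_hits_def lep_hits_def non_hits_def
  \<comment> \<open>The pattern splits only conjunctions whose left side is an implication, so each
    conclusion keeps the shape of \<open>law\<close>.\<close>
  proof (intro conjI [of "_ \<longrightarrow> _"] impI, goal_cases)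
    case 1
    then show ?case
      by (intro law) (auto simp: assms(6))
  next
    case 2
    then show ?case
      by (intro law) (auto simp: assms(5))
  next
    case 3
    then show ?case
      by (intro law p3) (auto simp: assms(7))
  qed
qed

end
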